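(* Let $m\le r$ be positive integers and put $\beta(m,r)=1-r^{-m}\,\frac{r!}{(r-m)!}$. Finitely jointly row-column exchangeable probabilities on $m\times m$ matrices that are extendible to $r$ dimensions are bounded in total variation distance from infinitely jointly row-column exchangeable probabilities by $2\beta(m,r)$. That is, for every such probability $P$ there is an infinitely jointly row-column exchangeable probability whose projection $P_{\infty,m}$ onto $m\times m$ matrices satisfies $$\|P-P_{\infty,m}\|\le 2\beta(m,r),$$ where $\|\cdot\|$ denotes total variation distance. This bound is sharp.
   Context: The distribution of a random $m\times m$ matrix $X$ (a relational data matrix representing a network on $m$ nodes) is jointly row-column exchangeable if for every permutation $g\in S_m$ the matrix $gX$ has the same distribution as $X$, where $g$ acts on the rows and columns of $X$ simultaneously. A jointly row-column exchangeable distribution on $m\times m$ matrices is extendible to $r$ dimensions if it is the marginal distribution (of an $m\times m$ submatrix indexed by $m$ of the $r$ nodes) of a jointly row-column exchangeable distribution on $r\times r$ matrices. An infinitely jointly row-column exchangeable probability is the distribution of an infinite array $(X_{ij})_{i,j\ge 1}$ that is invariant under simultaneous permutation of its row and column indices by the same permutation; its projection onto $m\times m$ matrices is the marginal distribution of the leading $m\times m$ submatrix. *)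

theory Defs
  imports "HOL-Probability.Probability" "HOL-Combinatorics.Permutations"
begin

text \<open>
  A matrix with rows and columns labelled by \<open>I\<close> and entries in the measurable space \<open>S\<close> is a point
  of the product space over \<open>I \<times> I\<close>. Nodes are numbered from \<open>0\<close>: \<open>I = {..<m}\<close> gives the
  \<open>m \<times> m\<close> matrices and \<open>I = UNIV\<close> the infinite arrays. Only the \<open>\<sigma>\<close>-algebra of this space
  is ever used, never the measure of \<open>S\<close> or of the product.
\<close>

definition array_space :: "'a measure \<Rightarrow> nat set \<Rightarrow> (nat \<times> nat \<Rightarrow> 'a) measure" where
  "array_space S I = PiM (I \<times> I) (\<lambda>_. S)"

definition relabel :: "nat set \<Rightarrow> (nat \<Rightarrow> nat) \<Rightarrow> (nat \<times> nat \<Rightarrow> 'a) \<Rightarrow> nat \<times> nat \<Rightarrow> 'a" where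
  "relabel I g X = restrict (\<lambda>(i, j). X (g i, g j)) (I \<times> I)"

text \<open>For \<open>I = UNIV\<close>, the condition \<open>g permutes I\<close> says that \<open>g\<close> is a bijection of the naturals.\<close>

definition jointly_exchangeable ::
    "'a measure \<Rightarrow> nat set \<Rightarrow> (nat \<times> nat \<Rightarrow> 'a) measure \<Rightarrow> bool" where
  "jointly_exchangeable S I P \<longleftrightarrow>
     prob_space P \<and> sets P = sets (array_space S I) \<and>
     (\<forall>g. g permutes I \<longrightarrow> distr P (array_space S I) (relabel I g) = P)"

definition submatrix_marginal ::
    "'a measure \<Rightarrow> nat \<Rightarrow> (nat \<times> nat \<Rightarrow> 'a) measure \<Rightarrow> (nat \<times> nat \<Rightarrow> 'a) measure" where
  "submatrix_marginal S m R =
     distr R (array_space S {..<m}) (\<lambda>X. restrict X ({..<m} \<times> {..<m}))"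

text \<open>
  By exchangeability of \<open>R\<close> every choice of \<open>m\<close> of the \<open>r\<close> nodes gives the same marginal, so the
  leading submatrix is used.
\<close>

definition extendible ::
    "'a measure \<Rightarrow> nat \<Rightarrow> nat \<Rightarrow> (nat \<times> nat \<Rightarrow> 'a) measure \<Rightarrow> bool" where
  "extendible S m r P \<longleftrightarrow>
     (\<exists>R. jointly_exchangeable S {..<r} R \<and> submatrix_marginal S m R = P)"

text \<open>
  Total variation distance in the normalisation of the norm of the signed measure \<open>P - Q\<close>, with
  values in \<open>[0, 2]\<close> on probability measures with the same \<open>\<sigma>\<close>-algebra. With the other usual
  normalisation, without the factor 2, the constant \<open>2 * beta m r\<close> below would not be sharp.
\<close>

definition tv_dist :: "'b measure \<Rightarrow> 'b measure \<Rightarrow> real" where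
  "tv_dist P Q = 2 * (SUP A\<in>sets P. \<bar>measure P A - measure Q A\<bar>)"

definition beta :: "nat \<Rightarrow> nat \<Rightarrow> real" where
  "beta m r = 1 - inverse (real r ^ m) * (fact r / fact (r - m))"

text \<open>
  \<^term>\<open>distr\<close> is a push-forward only along measurable maps; the maps used above are measurable.
\<close>

lemma measurable_relabel:
  assumes "g permutes I"
  shows "relabel I g \<in> measurable (array_space S I) (array_space S I)"
proof -
  have "(\<lambda>X. X (g (fst p), g (snd p))) \<in> measurable (PiM (I \<times> I) (\<lambda>_. S)) S" if "p \<in> I \<times> I" for p
    using that assms by (intro measurable_component_singleton) (auto simp: permutes_in_image)
  then show ?thesis
    unfolding relabel_def array_space_def case_prod_beta by (rule measurable_restrict)
qed

lemma measurable_submatrix: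
  assumes "{..<m} \<subseteq> I"
  shows "(\<lambda>X. restrict X ({..<m} \<times> {..<m}))
           \<in> measurable (array_space S I) (array_space S {..<m})"
  unfolding array_space_def using assms by (intro measurable_restrict_subset) auto

end

theory Submission
  imports Defs
begin

text \<open>
  Upper bound: let \<open>R\<close> be an exchangeable extension of \<open>P\<close> to \<open>r\<close> nodes, let \<open>X\<close> have law \<open>R\<close>, and
  sample nodes \<open>u 0, u 1, \<dots>\<close> independently and uniformly with replacement. The array with entries
  \<open>X (u i, u j)\<close> is infinitely exchangeable, and given that \<open>u 0, \<dots>, u (m - 1)\<close> are distinct, an
  event of probability \<open>1 - beta m r\<close>, its leading submatrix has law \<open>P\<close>.

  Sharpness: let every entry of row \<open>i\<close> be \<open>\<sigma> i\<close> for a uniformly random permutation \<open>\<sigma>\<close> of the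
  \<open>r\<close> nodes. Its diagonal has distinct values in \<open>{..<r}\<close>. In an infinitely exchangeable array, the
  first \<open>m\<close> diagonal entries have this property with probability at most \<open>1 - beta m r\<close>: average over
  all \<open>m\<close>-subsets of the first \<open>N\<close> diagonal positions, bound the number of good subsets by
  Maclaurin's inequality for the multiplicities of the values, and let \<open>N\<close> tend to infinity. Averaging
  over finitely many positions replaces de Finetti's theorem.
\<close>

section \<open>Maclaurin's inequality and injective samples\<close>

text \<open>Convexity of \<open>t ^ Suc n\<close> on the nonnegative reals: the left side is the
  tangent at \<open>a\<close>, evaluated at \<open>b\<close>.\<close>

lemma power_tangent_le:
  fixes a b :: real
  assumes "0 \<le> a" "0 \<le> b"
  shows "a ^ n * ((real n + 1) * b - real n * a) \<le> b ^ Suc n"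
proof (induction n)
  case (Suc n)
  \<comment> \<open>\<open>b\<close> times the tangent value for \<open>n\<close> exceeds the
    tangent value for \<open>Suc n\<close> by a nonnegative multiple of the square of
    \<open>b - a\<close>.\<close>
  have "a ^ Suc n * ((real (Suc n) + 1) * b - real (Suc n) * a)
      = b * (a ^ n * ((real n + 1) * b - real n * a)) - (real n + 1) * a ^ n * (b - a)\<^sup>2"
    by (simp add: algebra_simps power2_eq_square)
  also have "\<dots> \<le> b * b ^ Suc n"
    using mult_left_mono[OF Suc assms(2)] assms(1)
    by (smt (verit) mult_nonneg_nonneg of_nat_0_le_iff zero_le_power zero_le_power2)
  finally show ?case by simp
qed simp

text \<open>Maclaurin's inequality. Inserting one more variable turns it into the tangent line inequality
  for \<open>t \<mapsto> t ^ n\<close> at the mean of the old variables.\<close>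

lemma elementary_symmetric_sum_le:
  fixes p :: "'i \<Rightarrow> real"
  assumes "finite A" "\<And>i. i \<in> A \<Longrightarrow> 0 \<le> p i"
  shows "(\<Sum>T | T \<subseteq> A \<and> card T = k. \<Prod>i\<in>T. p i)
           \<le> real (card A choose k) * ((\<Sum>i\<in>A. p i) / real (card A)) ^ k"
  using assms
proof (induction A arbitrary: k rule: finite_induct)
  case empty
  have "{T :: 'i set. T \<subseteq> {} \<and> card T = k} = (if k = 0 then {{}} else {})"
    by auto
  then show ?case by simp
next
  case (insert x A)
  show ?case
  proof (cases k)
    case 0
    have "{T. T \<subseteq> insert x A \<and> card T = 0} = {{}}"
      using insert.hyps(1) by (auto simp: finite_subset card_0_eq dest: finite_subset[rotated])
    then show ?thesis using 0 by simp
  next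
    case (Suc n)
    let ?F = "\<lambda>k. {T. T \<subseteq> A \<and> card T = k}"
    define r where "r = card A"
    \<comment> \<open>\<open>a\<close> and \<open>b\<close> are the means without and with the new
      variable \<open>x\<close>; the tangent at \<open>a\<close> will be compared with the power at
      \<open>b\<close>.\<close>
    define a where "a = (\<Sum>i\<in>A. p i) / real r"
    define b where "b = (\<Sum>i\<in>insert x A. p i) / real (card (insert x A))"
    have fin: "finite (?F j)" for j
      using insert.hyps(1) by simp
    have notin: "x \<notin> T" and finT: "finite T" if "T \<in> ?F j" for T j
      using that insert.hyps finite_subset by auto
    have IH: "(\<Sum>T\<in>?F j. \<Prod>i\<in>T. p i) \<le> real (r choose j) * a ^ j" for j
      using insert.IH insert.prems by (simp add: a_def r_def)
    have a0: "0 \<le> a" and b0: "0 \<le> b"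
      unfolding a_def b_def using insert.prems by (auto intro!: divide_nonneg_nonneg sum_nonneg)
    \<comment> \<open>For \<open>r = 0\<close> division by zero gives \<open>a = 0\<close>, and the
      equation survives because the sum is empty.\<close>
    have sum_eq: "(\<Sum>i\<in>A. p i) = real r * a"
      using insert.hyps(1) by (cases "r = 0") (auto simp: a_def r_def)
    have card_ins: "card (insert x A) = Suc r"
      using insert.hyps by (simp add: r_def)
    have px: "p x = (real r + 1) * b - real r * a"
      using insert.hyps sum_eq card_ins by (simp add: b_def field_simps)
    \<comment> \<open>Both binomials with upper index \<open>r\<close> are written as multiples of
      \<open>Suc r choose Suc n\<close>, which then factors out of the whole bound.\<close>
    have choose_n: "real (r choose n) = real (Suc r choose Suc n) * (real n + 1) / (real r + 1)"
      using arg_cong[OF Suc_times_binomial[of n r], of real]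
      by (simp add: field_simps del: binomial_Suc_Suc)
    have "real (Suc r choose Suc n) = real (r choose n) + real (r choose Suc n)"
      by simp
    then have choose_Suc:
      "real (r choose Suc n) = real (Suc r choose Suc n) * (real r - real n) / (real r + 1)"
      unfolding choose_n by (simp add: field_simps)
    have split: "{T. T \<subseteq> insert x A \<and> card T = Suc n} = ?F (Suc n) \<union> insert x ` ?F n"
    proof (intro equalityI subsetI)
      fix T assume T: "T \<in> {T. T \<subseteq> insert x A \<and> card T = Suc n}"
      show "T \<in> ?F (Suc n) \<union> insert x ` ?F n"
      proof (cases "x \<in> T")
        case True
        then have "T = insert x (T - {x})" "T - {x} \<in> ?F n"
          using T by auto
        then show ?thesis by blast
      qed (use T in auto)
    next
      fix T assume "T \<in> ?F (Suc n) \<union> insert x ` ?F n"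
      then show "T \<in> {T. T \<subseteq> insert x A \<and> card T = Suc n}"
      proof
        assume "T \<in> insert x ` ?F n"
        then obtain T' where "T = insert x T'" "T' \<in> ?F n" by blast
        then show ?thesis using notin[of T' n] finT[of T' n] by auto
      qed auto
    qed
    have inj: "inj_on (insert x) (?F n)"
      using notin by (intro inj_onI) (metis insert_ident)
    have "(\<Sum>T | T \<subseteq> insert x A \<and> card T = Suc n. \<Prod>i\<in>T. p i)
        = (\<Sum>T\<in>?F (Suc n). \<Prod>i\<in>T. p i) + (\<Sum>T\<in>insert x ` ?F n. \<Prod>i\<in>T. p i)"
      unfolding split
    proof (intro sum.union_disjoint fin finite_imageI)
      show "?F (Suc n) \<inter> insert x ` ?F n = {}" using notin[of _ "Suc n"] by blast
    qed
    also have "(\<Sum>T\<in>insert x ` ?F n. \<Prod>i\<in>T. p i) = (\<Sum>T\<in>?F n. p x * (\<Prod>i\<in>T. p i))"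
    proof (subst sum.reindex[OF inj], rule sum.cong)
      fix T assume "T \<in> ?F n"
      then show "((\<lambda>T. \<Prod>i\<in>T. p i) \<circ> insert x) T = p x * (\<Prod>i\<in>T. p i)"
        using notin[of T n] finT[of T n] by (simp add: comp_def)
    qed simp
    also have "\<dots> = p x * (\<Sum>T\<in>?F n. \<Prod>i\<in>T. p i)"
      by (simp add: sum_distrib_left)
    also have "(\<Sum>T\<in>?F (Suc n). \<Prod>i\<in>T. p i) + p x * (\<Sum>T\<in>?F n. \<Prod>i\<in>T. p i)
        \<le> real (r choose Suc n) * a ^ Suc n + p x * (real (r choose n) * a ^ n)"
      by (intro add_mono mult_left_mono IH) (simp add: insert.prems)
    \<comment> \<open>With \<open>p x\<close> expressed by the two means, the factor
      \<open>r + 1\<close> cancels against the denominators and exactly the tangent value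
      remains.\<close>
    also have "\<dots> = real (Suc r choose Suc n) * (a ^ n * ((real n + 1) * b - real n * a))"
      unfolding choose_n choose_Suc px
      by (simp add: divide_simps del: binomial_Suc_Suc) (simp add: algebra_simps del: binomial_Suc_Suc)
    also have "\<dots> \<le> real (Suc r choose Suc n) * b ^ Suc n"
      by (intro mult_left_mono power_tangent_le a0 b0) simp
    finally show ?thesis
      unfolding Suc b_def card_ins .
  qed
qed

text \<open>Read \<open>Y\<close> as a colouring of \<open>K\<close>. A set counted here picks one
  point from each of \<open>k\<close> colour classes, so the count is at most the elementary
  symmetric sum of the class sizes. Maclaurin's inequality applies, since these sizes add up to at
  most \<open>card K\<close>.\<close>

lemma card_rainbow_le:
  fixes Y :: "'k \<Rightarrow> 'c"
  assumes "finite K" "finite C"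
  shows "real (card {U. U \<subseteq> K \<and> card U = k \<and> inj_on Y U \<and> Y ` U \<subseteq> C})
           \<le> real (card C choose k) * (real (card K) / real (card C)) ^ k"
proof -
  define n where "n c = card {i\<in>K. Y i = c}" for c
  \<comment> \<open>\<open>?G T\<close> consists of the transversals of the colour classes with
    colours in \<open>T\<close>.\<close>
  let ?G = "\<lambda>T. (\<lambda>f. f ` T) ` (PiE T (\<lambda>c. {i\<in>K. Y i = c}))"
  have finG: "finite (?G T)" if "T \<subseteq> C" for T
    using that assms by (intro finite_imageI finite_PiE) (auto intro: finite_subset)
  have sub: "{U. U \<subseteq> K \<and> card U = k \<and> inj_on Y U \<and> Y ` U \<subseteq> C}
      \<subseteq> (\<Union>T\<in>{T. T \<subseteq> C \<and> card T = k}. ?G T)"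
  proof
    fix U assume U: "U \<in> {U. U \<subseteq> K \<and> card U = k \<and> inj_on Y U \<and> Y ` U \<subseteq> C}"
    \<comment> \<open>Inverting \<open>Y\<close> on \<open>U\<close> gives the choice function that
      exhibits \<open>U\<close> as a transversal for its own colours.\<close>
    define f where "f = restrict (the_inv_into U Y) (Y ` U)"
    have "f \<in> PiE (Y ` U) (\<lambda>c. {i\<in>K. Y i = c})"
      using U by (auto simp: f_def the_inv_into_f_f)
    moreover have "U = f ` Y ` U"
      using U by (auto simp: f_def the_inv_into_f_f image_image)
    ultimately have "U \<in> ?G (Y ` U)" by blast
    moreover have "card (Y ` U) = k"
      using U by (simp add: card_image)
    ultimately show "U \<in> (\<Union>T\<in>{T. T \<subseteq> C \<and> card T = k}. ?G T)"
      using U by blast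
  qed
  have "card {U. U \<subseteq> K \<and> card U = k \<and> inj_on Y U \<and> Y ` U \<subseteq> C}
      \<le> card (\<Union>T\<in>{T. T \<subseteq> C \<and> card T = k}. ?G T)"
    using finG assms(2) by (intro card_mono sub) auto
  also have "\<dots> \<le> (\<Sum>T | T \<subseteq> C \<and> card T = k. card (?G T))"
    using assms(2) by (intro card_UN_le) simp
  also have "\<dots> \<le> (\<Sum>T | T \<subseteq> C \<and> card T = k. \<Prod>c\<in>T. n c)"
  proof (rule sum_mono)
    fix T assume "T \<in> {T. T \<subseteq> C \<and> card T = k}"
    then have "finite T" using assms(2) finite_subset by auto
    have "card (?G T) \<le> card (PiE T (\<lambda>c. {i\<in>K. Y i = c}))"
      using \<open>finite T\<close> assms(1) by (intro card_image_le finite_PiE) auto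
    then show "card (?G T) \<le> (\<Prod>c\<in>T. n c)"
      using \<open>finite T\<close> by (simp add: card_PiE n_def)
  qed
  finally have "real (card {U. U \<subseteq> K \<and> card U = k \<and> inj_on Y U \<and> Y ` U \<subseteq> C})
      \<le> (\<Sum>T | T \<subseteq> C \<and> card T = k. \<Prod>c\<in>T. real (n c))"
    by (simp flip: of_nat_prod of_nat_sum)
  also have "\<dots> \<le> real (card C choose k) * ((\<Sum>c\<in>C. real (n c)) / real (card C)) ^ k"
    using assms by (intro elementary_symmetric_sum_le) auto
  also have "\<dots> \<le> real (card C choose k) * (real (card K) / real (card C)) ^ k"
  proof -
    \<comment> \<open>Points of \<open>K\<close> whose colour lies outside \<open>C\<close> are
      missed, hence only an inequality with \<open>card K\<close>.\<close>
    have "(\<Sum>c\<in>C. n c) = card (\<Union>c\<in>C. {i\<in>K. Y i = c})"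
      unfolding n_def using assms by (subst card_UN_disjoint) auto
    also have "\<dots> \<le> card K"
      using assms by (auto intro!: card_mono)
    finally have "(\<Sum>c\<in>C. real (n c)) \<le> real (card K)"
      by (simp flip: of_nat_sum)
    then show ?thesis
      by (intro mult_left_mono power_mono divide_right_mono) (auto intro!: sum_nonneg divide_nonneg_nonneg)
  qed
  finally show ?thesis .
qed

text \<open>The complements of \<open>D\<close> and of its image in the finite set \<open>C\<close>
  have equal size, so any bijection between them completes \<open>f\<close>. Exchangeability, stated
  for permutations, thereby reaches injective choices of nodes.\<close>

lemma ex_permutes_extending:
  assumes "finite C" "D \<subseteq> C" "inj_on f D" "f ` D \<subseteq> C"
  obtains g where "g permutes C" "\<And>x. x \<in> D \<Longrightarrow> g x = f x"
proof -
  have "finite D" using assms finite_subset by blast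
  have "card (C - D) = card (C - f ` D)"
    using assms \<open>finite D\<close> by (simp add: card_Diff_subset card_image)
  then obtain h where h: "bij_betw h (C - D) (C - f ` D)"
    using assms(1) finite_same_card_bij[of "C - D" "C - f ` D"] by auto
  define g where "g x = (if x \<in> D then f x else if x \<in> C then h x else x)" for x
  have "bij_betw (\<lambda>x. if x \<in> D then f x else h x) (D \<union> (C - D)) (f ` D \<union> (C - f ` D))"
    using assms h by (intro bij_betw_disjoint_Un) (auto simp: bij_betw_def)
  moreover have "D \<union> (C - D) = C" "f ` D \<union> (C - f ` D) = C"
    using assms by auto
  ultimately have "bij_betw (\<lambda>x. if x \<in> D then f x else h x) C C" by simp
  then have "bij_betw g C C"
    by (rule bij_betw_cong[THEN iffD1, rotated]) (simp add: g_def)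
  then have "g permutes C"
    using assms(2) by (intro bij_imp_permutes) (auto simp: g_def)
  then show thesis
    using that by (simp add: g_def)
qed

text \<open>\<open>1 - beta m r\<close> is the probability that \<open>m\<close> uniform draws from
  \<open>r\<close> nodes are pairwise distinct. The binomial form is the one that Maclaurin's
  inequality produces.\<close>

lemma beta_eq_binomial:
  assumes "m \<le> r"
  shows "1 - beta m r = fact m * real (r choose m) / real r ^ m"
  using assms by (simp add: beta_def binomial_fact field_simps)

section \<open>Exchangeable arrays and total variation\<close>

text \<open>A permutation of the first \<open>m\<close> nodes fixes all other nodes, so it also
  permutes \<open>I\<close>, and relabelling by it commutes with restriction to the leading
  submatrix.\<close>

lemma jointly_exchangeable_submatrix_marginal:
  fixes S :: "'a measure"
  assumes R: "jointly_exchangeable S I R" and "{..<m} \<subseteq> I"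
  shows "jointly_exchangeable S {..<m} (submatrix_marginal S m R)"
proof -
  let ?res = "\<lambda>X. restrict X ({..<m} \<times> {..<m})"
  have setsR [measurable_cong]: "sets R = sets (array_space S I)"
    using R by (simp add: jointly_exchangeable_def)
  have res: "?res \<in> measurable R (array_space S {..<m})"
    using measurable_submatrix[OF assms(2)] by (simp cong: measurable_cong_sets add: setsR)
  interpret R: prob_space R
    using R by (simp add: jointly_exchangeable_def)
  have "distr (submatrix_marginal S m R) (array_space S {..<m}) (relabel {..<m} g)
      = submatrix_marginal S m R" if g: "g permutes {..<m}" for g
  proof -
    have gI: "g permutes I"
      using g assms(2) by (rule permutes_subset)
    have rel: "relabel I g \<in> measurable R (array_space S I)"
      using measurable_relabel[OF gI] by (simp cong: measurable_cong_sets add: setsR)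
    have "g i < m" if "i < m" for i
      using permutes_in_image[OF g, of i] that by simp
    then have "relabel {..<m} g \<circ> ?res = (?res \<circ> relabel I g :: (nat \<times> nat \<Rightarrow> 'a) \<Rightarrow> _)"
      using assms(2) by (auto simp: relabel_def fun_eq_iff restrict_def)
    then have "distr (submatrix_marginal S m R) (array_space S {..<m}) (relabel {..<m} g)
        = distr (distr R (array_space S I) (relabel I g)) (array_space S {..<m}) ?res"
      unfolding submatrix_marginal_def distr_distr[OF measurable_relabel[OF g] res]
        distr_distr[OF measurable_submatrix[OF assms(2)] rel] by simp
    also have "distr R (array_space S I) (relabel I g) = R"
      using R gI by (simp add: jointly_exchangeable_def)
    finally show ?thesis
      by (simp only: submatrix_marginal_def)
  qed
  then show ?thesis
    unfolding jointly_exchangeable_def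
    using R.prob_space_distr[OF res] by (simp add: submatrix_marginal_def)
qed

lemma measure_jointly_exchangeable_preimage:
  assumes R: "jointly_exchangeable S I R" and "g permutes I" "E \<in> sets R"
  shows "measure R (relabel I g -` E \<inter> space R) = measure R E"
proof -
  have sets: "sets R = sets (array_space S I)"
    and eq: "distr R (array_space S I) (relabel I g) = R"
    using R assms(2) by (auto simp: jointly_exchangeable_def)
  have "relabel I g \<in> measurable R (array_space S I)"
    using measurable_relabel[OF assms(2)] by (simp cong: measurable_cong_sets add: sets)
  then have "measure (distr R (array_space S I) (relabel I g)) E
      = measure R (relabel I g -` E \<inter> space R)"
    using assms(3) sets by (intro measure_distr) auto
  then show ?thesis by (simp add: eq)
qed

lemma tv_dist_le:
  assumes "\<And>E. E \<in> sets P \<Longrightarrow> \<bar>measure P E - measure Q E\<bar> \<le> c"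
  shows "tv_dist P Q \<le> 2 * c"
proof -
  have "(SUP E\<in>sets P. \<bar>measure P E - measure Q E\<bar>) \<le> c"
    using assms by (intro cSUP_least) auto
  then show ?thesis by (simp add: tv_dist_def)
qed

lemma tv_dist_ge:
  assumes "prob_space P" "prob_space Q" "E \<in> sets P"
  shows "2 * (measure P E - measure Q E) \<le> tv_dist P Q"
proof -
  interpret P: prob_space P by fact
  interpret Q: prob_space Q by fact
  \<comment> \<open>A supremum of reals dominates the members of the family only when the family is
    bounded above.\<close>
  have "\<bar>measure P F - measure Q F\<bar> \<le> 1" for F
    using P.prob_le_1[of F] Q.prob_le_1[of F] measure_nonneg[of P F] measure_nonneg[of Q F]
    by linarith
  then have "bdd_above ((\<lambda>F. \<bar>measure P F - measure Q F\<bar>) ` sets P)"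
    by (intro bdd_aboveI[of _ 1]) auto
  then have "\<bar>measure P E - measure Q E\<bar> \<le> (SUP F\<in>sets P. \<bar>measure P F - measure Q F\<bar>)"
    using assms(3) by (intro cSUP_upper2) auto
  then have "measure P E - measure Q E \<le> (SUP F\<in>sets P. \<bar>measure P F - measure Q F\<bar>)"
    by (rule order_trans[OF abs_ge_self])
  then show ?thesis
    unfolding tv_dist_def by (rule mult_left_mono) simp
qed

section \<open>Sampling nodes with replacement\<close>

locale node_sampling =
  fixes S :: "'a measure" and r :: nat and R :: "(nat \<times> nat \<Rightarrow> 'a) measure"
  assumes r_pos: "0 < r" and exch: "jointly_exchangeable S {..<r} R"
begin

sublocale R: prob_space R
  using exch by (simp add: jointly_exchangeable_def)

lemma sets_R: "sets R = sets (array_space S {..<r})"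
  using exch by (simp add: jointly_exchangeable_def)

definition nodes :: "(nat \<Rightarrow> nat) measure" where
  "nodes = PiM UNIV (\<lambda>_. uniform_count_measure {..<r})"

text \<open>Nodes may repeat: if \<open>u i = u j\<close> with \<open>i \<noteq> j\<close>, then the
  entry at \<open>(i, j)\<close> is a diagonal entry of \<open>X\<close>. Such samples account for
  the error \<open>beta m r\<close>.\<close>

definition sample :: "(nat \<Rightarrow> nat) \<times> (nat \<times> nat \<Rightarrow> 'a) \<Rightarrow> nat \<times> nat \<Rightarrow> 'a" where
  "sample = (\<lambda>(u, X). \<lambda>(i, j). X (u i, u j))"

text \<open>One array \<open>X\<close> with law \<open>R\<close> serves all entries; given
  \<open>X\<close>, the randomness comes from the independent nodes alone.\<close>

definition mixture :: "(nat \<times> nat \<Rightarrow> 'a) measure" where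
  "mixture = distr (nodes \<Otimes>\<^sub>M R) (array_space S UNIV) sample"

sublocale unif: prob_space "uniform_count_measure {..<r}"
  using r_pos by (intro prob_space_uniform_count_measure) auto

sublocale iid: product_prob_space "\<lambda>_::nat. uniform_count_measure {..<r}" UNIV
  by unfold_locales

sublocale nodes: prob_space nodes
  unfolding nodes_def by unfold_locales

sublocale pair: pair_prob_space nodes R
  by unfold_locales

lemma measurable_node: "(\<lambda>u. u i) \<in> measurable nodes (count_space {..<r})"
proof -
  have "(\<lambda>u. u i) \<in> measurable nodes (uniform_count_measure {..<r})"
    unfolding nodes_def by (rule measurable_component_singleton) simp
  then show ?thesis
    by (simp only: measurable_cong_sets[OF refl sets_uniform_count_measure_count_space])
qed

text \<open>Each entry evaluates \<open>X\<close> at a random position that takes finitely many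
  values, so measurability can be checked for each fixed position.\<close>

lemma measurable_sample: "sample \<in> measurable (nodes \<Otimes>\<^sub>M R) (array_space S UNIV)"
proof -
  have entry: "(\<lambda>\<omega>. snd \<omega> (fst \<omega> i, fst \<omega> j)) \<in> measurable (nodes \<Otimes>\<^sub>M R) S" for i j
  proof (rule measurable_compose_countable'[where I = "{..<r} \<times> {..<r}"
        and f = "\<lambda>p \<omega>. snd \<omega> p" and g = "\<lambda>\<omega>. (fst \<omega> i, fst \<omega> j)"])
    fix p assume p: "p \<in> {..<r} \<times> {..<r}"
    have "(\<lambda>X. X p) \<in> measurable (array_space S {..<r}) S"
      unfolding array_space_def using p by (rule measurable_component_singleton)
    then have "(\<lambda>X. X p) \<in> measurable R S"
      by (simp cong: measurable_cong_sets add: sets_R)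
    then show "(\<lambda>\<omega>. snd \<omega> p) \<in> measurable (nodes \<Otimes>\<^sub>M R) S"
      by (rule measurable_compose[OF measurable_snd])
  next
    have "(\<lambda>\<omega>. (fst \<omega> i, fst \<omega> j))
        \<in> measurable (nodes \<Otimes>\<^sub>M R) (count_space {..<r} \<Otimes>\<^sub>M count_space {..<r})"
      by (intro measurable_Pair measurable_compose[OF measurable_fst] measurable_node)
    then show "(\<lambda>\<omega>. (fst \<omega> i, fst \<omega> j))
        \<in> measurable (nodes \<Otimes>\<^sub>M R) (count_space ({..<r} \<times> {..<r}))"
      by (simp add: pair_measure_countable)
  qed (auto intro: countable_finite)
  show ?thesis
    unfolding array_space_def sample_def case_prod_beta
    by (intro measurable_PiM_single' entry) (use measurable_space[OF entry] in \<open>force simp: space_PiM\<close>)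
qed

text \<open>Relabelling the sampled array by \<open>g\<close> amounts to replacing the node sequence
  \<open>u\<close> by \<open>u \<circ> g\<close>, and the law of an independent, identically
  distributed sequence is unchanged by this.\<close>

lemma jointly_exchangeable_mixture: "jointly_exchangeable S UNIV mixture"
proof -
  have "distr mixture (array_space S UNIV) (relabel UNIV g) = mixture" if g: "g permutes UNIV" for g
  proof -
    let ?h = "\<lambda>u :: nat \<Rightarrow> nat. u \<circ> g"
    have nodes_eq: "distr nodes nodes ?h = nodes"
      using distr_PiM_reindex[of UNIV "\<lambda>_. uniform_count_measure {..<r}" g UNIV]
        unif.prob_space_axioms permutes_inj[OF g]
      by (simp add: nodes_def comp_def restrict_UNIV)
    have h: "?h \<in> measurable nodes nodes"
      unfolding nodes_def comp_def by (rule measurable_PiM_single') (auto simp: space_PiM)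
    have hid: "(\<lambda>(u, X). (?h u, X)) \<in> measurable (nodes \<Otimes>\<^sub>M R) (nodes \<Otimes>\<^sub>M R)"
      unfolding case_prod_beta
      by (intro measurable_Pair measurable_compose[OF measurable_fst h] measurable_snd)
    \<comment> \<open>\<open>R\<close> is written as its image under the identity so that the
      product of two push-forwards becomes one push-forward of the product.\<close>
    have "nodes \<Otimes>\<^sub>M R = distr nodes nodes ?h \<Otimes>\<^sub>M distr R R (\<lambda>X. X)"
      by (simp add: nodes_eq distr_id)
    also have "\<dots> = distr (nodes \<Otimes>\<^sub>M R) (nodes \<Otimes>\<^sub>M R) (\<lambda>(u, X). (?h u, X))"
      using h by (intro pair_measure_distr) (simp_all add: distr_id R.sigma_finite_measure_axioms)
    finally have inv: "distr (nodes \<Otimes>\<^sub>M R) (nodes \<Otimes>\<^sub>M R) (\<lambda>(u, X). (?h u, X)) = nodes \<Otimes>\<^sub>M R" ..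
    have "relabel UNIV g \<circ> sample = sample \<circ> (\<lambda>(u, X). (?h u, X))"
      by (auto simp: relabel_def sample_def fun_eq_iff)
    then have "distr mixture (array_space S UNIV) (relabel UNIV g)
        = distr (distr (nodes \<Otimes>\<^sub>M R) (nodes \<Otimes>\<^sub>M R) (\<lambda>(u, X). (?h u, X))) (array_space S UNIV) sample"
      unfolding mixture_def distr_distr[OF measurable_relabel[OF g] measurable_sample]
        distr_distr[OF measurable_sample hid] by simp
    then show ?thesis
      by (simp add: inv mixture_def)
  qed
  then show ?thesis
    unfolding jointly_exchangeable_def
    using pair.prob_space_distr[OF measurable_sample] by (simp add: mixture_def)
qed

lemma measure_nodes_prefix:
  assumes "v \<in> {..<m} \<rightarrow>\<^sub>E {..<r}"
  shows "{u \<in> space nodes. \<forall>i<m. u i = v i} \<in> sets nodes"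
    and "measure nodes {u \<in> space nodes. \<forall>i<m. u i = v i} = 1 / real r ^ m"
proof -
  let ?U = "uniform_count_measure {..<r}"
  \<comment> \<open>Fixing the first \<open>m\<close> nodes is a cylinder over one point, so its
    measure is a product of \<open>m\<close> factors \<open>1 / r\<close>.\<close>
  have eq: "{u \<in> space nodes. \<forall>i<m. u i = v i}
      = prod_emb UNIV (\<lambda>_. ?U) {..<m} (PiE {..<m} (\<lambda>i. {v i}))"
    by (auto simp: nodes_def prod_emb_def space_PiM PiE_iff extensional_def restrict_def)
  have v: "{v i} \<in> sets ?U" if "i < m" for i
    using assms that by (auto simp: sets_uniform_count_measure)
  show "{u \<in> space nodes. \<forall>i<m. u i = v i} \<in> sets nodes"
    unfolding eq unfolding nodes_def using v by (intro sets_PiM_I) auto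
  have "measure ?U {v i} = 1 / real r" if "i < m" for i
    using assms that by (subst measure_uniform_count_measure) auto
  then have "emeasure ?U {v i} = ennreal (1 / real r)" if "i < m" for i
    using that by (simp add: unif.emeasure_eq_measure)
  then have "emeasure nodes {u \<in> space nodes. \<forall>i<m. u i = v i} = (\<Prod>i<m. ennreal (1 / real r))"
    unfolding eq unfolding nodes_def using v by (subst iid.emeasure_PiM_emb) (auto intro!: prod.cong)
  also have "\<dots> = ennreal ((1 / real r) ^ m)"
    by (simp add: ennreal_power)
  finally have "emeasure nodes {u \<in> space nodes. \<forall>i<m. u i = v i} = ennreal ((1 / real r) ^ m)" .
  then show "measure nodes {u \<in> space nodes. \<forall>i<m. u i = v i} = 1 / real r ^ m"
    unfolding measure_def by (simp only: enn2real_ennreal zero_le_power zero_le_divide_1_iff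
        of_nat_0_le_iff power_one_over)
qed

text \<open>Let \<open>q\<close> be the probability of \<open>E\<close> under the marginal of
  \<open>R\<close>. Samples with distinct leading nodes contribute exactly
  \<open>(1 - beta m r) * q\<close> to the probability of \<open>E\<close> under the mixture; all
  other samples contribute between 0 and \<open>beta m r\<close>.\<close>

lemma measure_mixture_marginal:
  assumes m: "m \<le> r" and E: "E \<in> sets (array_space S {..<m})"
  shows "\<bar>measure (submatrix_marginal S m R) E - measure (submatrix_marginal S m mixture) E\<bar> \<le> beta m r"
proof -
  let ?res = "\<lambda>X. restrict X ({..<m} \<times> {..<m})"
  let ?q = "measure (submatrix_marginal S m R) E"
  \<comment> \<open>\<open>V\<close> lists the injective prefixes, \<open>N v\<close> is the event
    that the nodes start with \<open>v\<close>, and \<open>X v\<close> collects the arrays whose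
    submatrix read off along \<open>v\<close> lies in \<open>E\<close>.\<close>
  define V where "V = {v \<in> {..<m} \<rightarrow>\<^sub>E {..<r}. inj_on v {..<m}}"
  define N where "N v = {u \<in> space nodes. \<forall>i<m. u i = v i}" for v :: "nat \<Rightarrow> nat"
  define X where "X v = {x \<in> space R. (\<lambda>(i, j)\<in>{..<m} \<times> {..<m}. x (v i, v j)) \<in> E}" for v
  define G where "G = (?res \<circ> sample) -` E \<inter> space (nodes \<Otimes>\<^sub>M R)"
  have finV: "finite V"
    unfolding V_def by (rule finite_subset[where B = "{..<m} \<rightarrow>\<^sub>E {..<r}"]) (auto intro: finite_PiE)
  have cardV: "real (card V) / real r ^ m = 1 - beta m r"
  proof -
    have "card V = (\<Prod>i=0..<m. r - i)"
      unfolding V_def by (subst card_inj_on_subset_funcset) auto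
    then have "real (card V) = (\<Prod>i=0..<m. real r - real i)"
      using m by (auto simp: of_nat_diff intro!: prod.cong)
    also have "\<dots> = fact m * real (r choose m)"
      by (simp add: gbinomial_mult_fact binomial_gbinomial)
    finally show ?thesis
      unfolding beta_eq_binomial[OF m] by simp
  qed
  have res_R: "?res \<in> measurable R (array_space S {..<m})"
    unfolding measurable_cong_sets[OF sets_R refl] using m by (intro measurable_submatrix) simp
  \<comment> \<open>An injective prefix extends to a permutation of all \<open>r\<close> nodes, so
    exchangeability of \<open>R\<close> gives every \<open>X v\<close> the same probability as the
    leading submatrix.\<close>
  have XP: "X v \<in> sets R" "measure R (X v) = ?q" if v: "v \<in> V" for v
  proof -
    obtain g where g: "g permutes {..<r}" and gv: "\<And>i. i < m \<Longrightarrow> g i = v i"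
    proof (rule ex_permutes_extending[of "{..<r}" "{..<m}" v])
    qed (use v m in \<open>auto simp: V_def\<close>)
    let ?F = "?res -` E \<inter> space R"
    have F: "?F \<in> sets R"
      using res_R E by (rule measurable_sets)
    have rel: "relabel {..<r} g \<in> measurable R R"
      using measurable_relabel[OF g] by (simp cong: measurable_cong_sets add: sets_R)
    have "?res (relabel {..<r} g x) = (\<lambda>(i, j)\<in>{..<m} \<times> {..<m}. x (v i, v j))" for x :: "nat \<times> nat \<Rightarrow> 'a"
      using m gv by (auto simp: relabel_def restrict_def fun_eq_iff)
    then have XF: "X v = relabel {..<r} g -` ?F \<inter> space R"
      using measurable_space[OF rel] by (auto simp: X_def)
    show "X v \<in> sets R"
      unfolding XF using rel F by (rule measurable_sets)
    show "measure R (X v) = ?q"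
      unfolding XF measure_jointly_exchangeable_preimage[OF exch g F]
      using res_R E by (simp add: submatrix_marginal_def measure_distr)
  qed
  have NV: "N v \<in> sets nodes" "measure nodes (N v) = 1 / real r ^ m" if "v \<in> V" for v
  proof -
    have "v \<in> {..<m} \<rightarrow>\<^sub>E {..<r}"
      using that by (simp add: V_def)
    then show "N v \<in> sets nodes" "measure nodes (N v) = 1 / real r ^ m"
      unfolding N_def by (rule measure_nodes_prefix)+
  qed
  have disjN: "disjoint_family_on N V"
    unfolding disjoint_family_on_def
  proof (intro ballI impI)
    fix v w assume vw: "v \<in> V" "w \<in> V" "v \<noteq> w"
    have "\<exists>i<m. v i \<noteq> w i"
    proof (rule ccontr)
      assume "\<not> (\<exists>i<m. v i \<noteq> w i)"
      then have "v = w"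
        using vw by (intro PiE_ext[of v "{..<m}" "\<lambda>_. {..<r}" w]) (auto simp: V_def)
      with vw show False by simp
    qed
    then show "N v \<inter> N w = {}"
      by (auto simp: N_def)
  qed
  have comp: "?res \<circ> sample \<in> measurable (nodes \<Otimes>\<^sub>M R) (array_space S {..<m})"
    by (rule measurable_comp[OF measurable_sample measurable_submatrix]) simp
  have G: "G \<in> sets (nodes \<Otimes>\<^sub>M R)"
    unfolding G_def using comp E by (rule measurable_sets)
  have "submatrix_marginal S m mixture = distr (nodes \<Otimes>\<^sub>M R) (array_space S {..<m}) (?res \<circ> sample)"
    unfolding submatrix_marginal_def mixture_def
    by (rule distr_distr[OF measurable_submatrix measurable_sample]) simp
  then have mG: "measure (submatrix_marginal S m mixture) E = measure (nodes \<Otimes>\<^sub>M R) G"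
    unfolding G_def using comp E by (simp add: measure_distr)
  \<comment> \<open>\<open>D\<close> is the event that the first \<open>m\<close> nodes are
    distinct, and \<open>D'\<close> is the part of it on which the sampled submatrix lies in
    \<open>E\<close>.\<close>
  define D where "D = (\<Union>v\<in>V. N v \<times> space R)"
  define D' where "D' = (\<Union>v\<in>V. N v \<times> X v)"
  have D: "D \<in> sets (nodes \<Otimes>\<^sub>M R)" and D': "D' \<in> sets (nodes \<Otimes>\<^sub>M R)"
    unfolding D_def D'_def by (intro sets.finite_UN finV pair_measureI NV XP sets.top; assumption)+
  have "measure (nodes \<Otimes>\<^sub>M R) D = (\<Sum>v\<in>V. measure (nodes \<Otimes>\<^sub>M R) (N v \<times> space R))"
    unfolding D_def using disjN
    by (intro pair.finite_measure_finite_Union finV image_subsetI pair_measureI NV sets.top)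
      (auto simp: disjoint_family_on_def)
  also have "\<dots> = (\<Sum>v\<in>V. 1 / real r ^ m)"
  proof (intro sum.cong refl)
    fix v assume "v \<in> V"
    then show "measure (nodes \<Otimes>\<^sub>M R) (N v \<times> space R) = 1 / real r ^ m"
      using NV[of v]
      by (simp add: measure_def R.emeasure_pair_measure_Times enn2real_mult R.emeasure_space_1)
  qed
  finally have mD: "measure (nodes \<Otimes>\<^sub>M R) D = 1 - beta m r"
    using cardV by simp
  have "measure (nodes \<Otimes>\<^sub>M R) D' = (\<Sum>v\<in>V. measure (nodes \<Otimes>\<^sub>M R) (N v \<times> X v))"
    unfolding D'_def using disjN
    by (intro pair.finite_measure_finite_Union finV image_subsetI pair_measureI NV XP)
      (auto simp: disjoint_family_on_def)
  also have "\<dots> = (\<Sum>v\<in>V. 1 / real r ^ m * ?q)"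
  proof (intro sum.cong refl)
    fix v assume "v \<in> V"
    have "measure (nodes \<Otimes>\<^sub>M R) (N v \<times> X v) = measure nodes (N v) * measure R (X v)"
      using NV[of v] XP[of v] \<open>v \<in> V\<close> by (simp add: measure_def R.emeasure_pair_measure_Times enn2real_mult)
    then show "measure (nodes \<Otimes>\<^sub>M R) (N v \<times> X v) = 1 / real r ^ m * ?q"
      using NV[of v] XP[of v] \<open>v \<in> V\<close> by simp
  qed
  finally have mD': "measure (nodes \<Otimes>\<^sub>M R) D' = (1 - beta m r) * ?q"
    by (simp flip: cardV)
  have samp: "(?res \<circ> sample) (u, x) = (\<lambda>(i, j)\<in>{..<m} \<times> {..<m}. x (v i, v j))" if "u \<in> N v" for u v x
    using that by (auto simp: N_def sample_def restrict_def fun_eq_iff)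
  have in_G: "(u, x) \<in> G \<longleftrightarrow> x \<in> X v" if "u \<in> N v" "x \<in> space R" for u x v
    using that samp[OF that(1), of x] by (simp add: G_def X_def N_def space_pair_measure)
  have "D' \<subseteq> G"
  proof
    fix \<omega> assume "\<omega> \<in> D'"
    then obtain v u x where "\<omega> = (u, x)" "u \<in> N v" "x \<in> X v"
      by (auto simp: D'_def)
    then show "\<omega> \<in> G"
      using in_G[of u v x] by (simp add: X_def)
  qed
  then have lower: "measure (nodes \<Otimes>\<^sub>M R) D' \<le> measure (nodes \<Otimes>\<^sub>M R) G"
    using G by (rule pair.finite_measure_mono)
  have "G \<subseteq> D' \<union> (space (nodes \<Otimes>\<^sub>M R) - D)"
  proof
    fix \<omega> assume \<omega>: "\<omega> \<in> G"
    show "\<omega> \<in> D' \<union> (space (nodes \<Otimes>\<^sub>M R) - D)"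
    proof (cases "\<omega> \<in> D")
      case True
      then obtain v u x where "\<omega> = (u, x)" "v \<in> V" "u \<in> N v" "x \<in> space R"
        by (auto simp: D_def)
      then have "\<omega> \<in> D'"
        using \<omega> in_G[of u v x] by (auto simp: D'_def)
      then show ?thesis by simp
    qed (use \<omega> G_def in simp)
  qed
  then have "measure (nodes \<Otimes>\<^sub>M R) G \<le> measure (nodes \<Otimes>\<^sub>M R) (D' \<union> (space (nodes \<Otimes>\<^sub>M R) - D))"
    using D D' by (intro pair.finite_measure_mono) auto
  also have "\<dots> \<le> measure (nodes \<Otimes>\<^sub>M R) D' + measure (nodes \<Otimes>\<^sub>M R) (space (nodes \<Otimes>\<^sub>M R) - D)"
    using D D' by (intro measure_Un_le) auto
  also have "measure (nodes \<Otimes>\<^sub>M R) (space (nodes \<Otimes>\<^sub>M R) - D) = beta m r"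
    using pair.prob_compl[OF D] mD by simp
  finally have upper: "measure (nodes \<Otimes>\<^sub>M R) G \<le> (1 - beta m r) * ?q + beta m r"
    by (simp add: mD')
  have b: "0 \<le> beta m r"
    using pair.prob_le_1[of D] mD by simp
  have q: "0 \<le> ?q" "?q \<le> 1"
    using prob_space.prob_le_1[OF R.prob_space_distr[OF res_R]] by (auto simp: submatrix_marginal_def)
  \<comment> \<open>The two deviations from \<open>?q\<close> are at most
    \<open>beta m r * ?q\<close> below and \<open>beta m r * (1 - ?q)\<close> above.\<close>
  have "beta m r * ?q \<le> beta m r" "0 \<le> beta m r * ?q"
    using b q by (auto simp: mult_left_le)
  then show ?thesis
    using lower upper b unfolding mD' mG left_diff_distrib by linarith
qed

end

section \<open>Distinct diagonal entries in infinitely exchangeable arrays\<close>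

text \<open>Joint relabelling permutes the diagonal as a sequence, so the property for
  \<open>U\<close> turns into the same property for the image of \<open>U\<close>. \<open>C\<close>
  is the set of admissible colours.\<close>

definition rainbow :: "nat set \<Rightarrow> 'c set \<Rightarrow> (nat \<times> nat \<Rightarrow> 'c) \<Rightarrow> bool" where
  "rainbow U C X \<longleftrightarrow> inj_on (\<lambda>i. X (i, i)) U \<and> (\<lambda>i. X (i, i)) ` U \<subseteq> C"

lemma sets_rainbow:
  fixes C :: "real set"
  assumes "U \<subseteq> I" "finite U" "C \<in> sets borel"
  shows "{X \<in> space (array_space borel I). rainbow U C X} \<in> sets (array_space borel I)"
proof -
  let ?M = "array_space (borel :: real measure) I"
  have comp: "(\<lambda>X. X (i, i)) \<in> borel_measurable ?M" if "i \<in> U" for i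
    unfolding array_space_def using that assms(1) by (intro measurable_component_singleton) auto
  have entry: "{X \<in> space ?M. X (i, i) \<in> C} \<in> sets ?M" if "i \<in> U" for i
  proof -
    have "(\<lambda>X. X (i, i)) -` C \<inter> space ?M = {X \<in> space ?M. X (i, i) \<in> C}"
      by auto
    then show ?thesis
      using measurable_sets[OF comp[OF that] assms(3)] by simp
  qed
  have diff: "{X \<in> space ?M. X (i, i) = X (j, j) \<longrightarrow> i = j} \<in> sets ?M" if "i \<in> U" "j \<in> U" for i j
    using sets.sets_Collect_neg[OF borel_measurable_eq[OF comp[OF that(1)] comp[OF that(2)]]]
    by (cases "i = j") simp_all
  have "{X \<in> space ?M. \<forall>i\<in>U. X (i, i) \<in> C \<and> (\<forall>j\<in>U. X (i, i) = X (j, j) \<longrightarrow> i = j)} \<in> sets ?M"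
  proof (rule sets.sets_Collect_countable_All')
    fix i assume i: "i \<in> U"
    have "{X \<in> space ?M. \<forall>j\<in>U. X (i, i) = X (j, j) \<longrightarrow> i = j} \<in> sets ?M"
      using diff[OF i] countable_finite[OF assms(2)] by (rule sets.sets_Collect_countable_All')
    then show "{X \<in> space ?M. X (i, i) \<in> C \<and> (\<forall>j\<in>U. X (i, i) = X (j, j) \<longrightarrow> i = j)} \<in> sets ?M"
      using entry[OF i] by (rule sets.sets_Collect_conj)
  qed (rule countable_finite[OF assms(2)])
  moreover have "rainbow U C X \<longleftrightarrow>
      (\<forall>i\<in>U. X (i, i) \<in> C \<and> (\<forall>j\<in>U. X (i, i) = X (j, j) \<longrightarrow> i = j))" for X
    by (auto simp: rainbow_def inj_on_def)
  ultimately show ?thesis by simp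
qed

lemma rainbow_relabel:
  assumes "g permutes I" "U \<subseteq> I"
  shows "rainbow U C (relabel I g X) \<longleftrightarrow> rainbow (g ` U) C X"
proof -
  have diag: "relabel I g X (i, i) = X (g i, g i)" if "i \<in> U" for i
    using that assms(2) by (auto simp: relabel_def)
  have "inj_on (\<lambda>i. relabel I g X (i, i)) U \<longleftrightarrow> inj_on ((\<lambda>i. X (i, i)) \<circ> g) U"
    by (intro inj_on_cong) (simp add: diag)
  also have "\<dots> \<longleftrightarrow> inj_on (\<lambda>i. X (i, i)) (g ` U)"
    by (rule comp_inj_on_iff[symmetric]) (rule permutes_inj_on[OF assms(1)])
  finally show ?thesis
    by (auto simp: rainbow_def diag)
qed

text \<open>The left side is the expected number of rainbow \<open>m\<close>-subsets of the first
  \<open>N\<close> positions, because exchangeability makes all these subsets equally likely to be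
  rainbow.\<close>

lemma choose_prob_rainbow_le:
  fixes C :: "real set"
  assumes Q: "jointly_exchangeable borel UNIV Q" and "finite C" "m \<le> N"
  shows "real (N choose m) * measure Q {X \<in> space Q. rainbow {..<m} C X}
           \<le> real (card C choose m) * (real N / real (card C)) ^ m"
proof -
  interpret Q: prob_space Q
    using Q by (simp add: jointly_exchangeable_def)
  have setsQ: "sets Q = sets (array_space borel UNIV)"
    using Q by (simp add: jointly_exchangeable_def)
  then have spQ: "space Q = space (array_space borel UNIV)"
    by (rule sets_eq_imp_space_eq)
  define E where "E U = {X \<in> space Q. rainbow U C X}" for U
  let ?\<U> = "{U. U \<subseteq> {..<N} \<and> card U = m}"
  have E: "E U \<in> sets Q" if "finite U" for U
    unfolding E_def spQ setsQ using that assms(2)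
    by (intro sets_rainbow) (auto intro: borel_closed finite_imp_closed)
  have same: "measure Q (E U) = measure Q (E {..<m})" if U: "U \<in> ?\<U>" for U
  proof -
    have "finite U" "card {..<m} = card U"
      using U finite_subset[of U "{..<N}"] by auto
    then obtain f where f: "bij_betw f {..<m} U"
      using finite_same_card_bij[of "{..<m}" U] by blast
    \<comment> \<open>A bijection from the first \<open>m\<close> positions onto \<open>U\<close> is
      completed inside \<open>{..<N}\<close>, and the result permutes the naturals by fixing
      everything from \<open>N\<close> on.\<close>
    obtain g where g: "g permutes {..<N}" and gf: "\<And>i. i \<in> {..<m} \<Longrightarrow> g i = f i"
      by (rule ex_permutes_extending[of "{..<N}" "{..<m}" f])
        (use f U assms(3) in \<open>auto simp: bij_betw_def\<close>)
    have gU: "g permutes UNIV"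
      using g by (rule permutes_subset) simp
    have "g ` {..<m} = U"
      using f gf by (simp add: bij_betw_def)
    moreover have "relabel UNIV g X \<in> space Q" if "X \<in> space Q" for X
      using that measurable_space[OF measurable_relabel[OF gU]] by (simp add: spQ)
    ultimately have "relabel UNIV g -` E {..<m} \<inter> space Q = E U"
      by (auto simp: E_def rainbow_relabel[OF gU])
    then show ?thesis
      using measure_jointly_exchangeable_preimage[OF Q gU E[of "{..<m}"]] by simp
  qed
  have fin: "finite ?\<U>" by simp
  have EU: "E U \<in> sets Q" if "U \<in> ?\<U>" for U
    using that finite_subset[of U "{..<N}"] by (intro E) auto
  have int: "integrable Q (indicator (E U) :: _ \<Rightarrow> real)" if "U \<in> ?\<U>" for U
    using EU[OF that] by (intro integrable_real_indicator) (auto simp: Q.emeasure_eq_measure)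
  have "real (N choose m) * measure Q (E {..<m}) = (\<Sum>U\<in>?\<U>. measure Q (E U))"
    using n_subsets[of "{..<N}" m] by (simp add: same)
  also have "\<dots> = (\<Sum>U\<in>?\<U>. Q.expectation (indicator (E U)))"
    by (intro sum.cong refl) (simp add: EU)
  also have "\<dots> = Q.expectation (\<lambda>X. \<Sum>U\<in>?\<U>. indicator (E U) X)"
    by (rule Bochner_Integration.integral_sum[symmetric]) (rule int)
  also have "\<dots> \<le> real (card C choose m) * (real N / real (card C)) ^ m"
  proof (rule Q.integral_le_const)
    show "integrable Q (\<lambda>X. \<Sum>U\<in>?\<U>. indicator (E U) X :: real)"
      by (rule Bochner_Integration.integrable_sum) (rule int)
    have "(\<Sum>U\<in>?\<U>. indicator (E U) X) \<le> real (card C choose m) * (real N / real (card C)) ^ m"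
      if "X \<in> space Q" for X
    proof -
      have "(\<Sum>U\<in>?\<U>. indicator (E U) X :: real) = (\<Sum>U\<in>?\<U>. if rainbow U C X then 1 else 0)"
        using that by (intro sum.cong) (auto simp: E_def)
      also have "\<dots> = real (card {U \<in> ?\<U>. rainbow U C X})"
        using fin by (simp add: sum.If_cases Int_def)
      \<comment> \<open>For each fixed \<open>X\<close> the diagonal is just a colouring of
        \<open>{..<N}\<close>, so the combinatorial bound holds pointwise.\<close>
      also have "{U \<in> ?\<U>. rainbow U C X}
          = {U. U \<subseteq> {..<N} \<and> card U = m \<and> inj_on (\<lambda>i. X (i, i)) U \<and> (\<lambda>i. X (i, i)) ` U \<subseteq> C}"
        by (auto simp: rainbow_def)
      finally show ?thesis
        using card_rainbow_le[of "{..<N}" C m "\<lambda>i. X (i, i)"] assms(2) by simp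
    qed
    then show "AE X in Q. (\<Sum>U\<in>?\<U>. indicator (E U) X) \<le> real (card C choose m) * (real N / real (card C)) ^ m"
      by (rule AE_I2)
  qed
  finally show ?thesis
    by (simp add: E_def)
qed

text \<open>With \<open>N = m + n\<close>, both sides of the averaged bound are divided by
  \<open>n ^ m\<close>. As \<open>n\<close> grows, the binomial on the left contributes
  \<open>1 / fact m\<close> and the power on the right tends to the constant that defines
  \<open>1 - beta m (card C)\<close>.\<close>

lemma prob_rainbow_le:
  fixes C :: "real set"
  assumes Q: "jointly_exchangeable borel UNIV Q" and C: "finite C" "m \<le> card C"
  shows "measure Q {X \<in> space Q. rainbow {..<m} C X} \<le> 1 - beta m (card C)"
proof -
  define r where "r = card C"
  define q where "q = measure Q {X \<in> space Q. rainbow {..<m} C X}"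
  have lim1: "(\<lambda>n. real ((m + n) choose n) / real (n ^ m) * q) \<longlonglongrightarrow> 1 / fact m * q"
    by (intro tendsto_mult fact_binomial_limit tendsto_const)
  have "(\<lambda>n. (real m / real n + 1) ^ m) \<longlonglongrightarrow> (0 + 1) ^ m"
    by (intro tendsto_intros lim_const_over_n)
  then have lim2: "(\<lambda>n. real (r choose m) / real r ^ m * (real m / real n + 1) ^ m)
      \<longlonglongrightarrow> real (r choose m) / real r ^ m * 1"
    by (intro tendsto_mult tendsto_const) simp
  have "1 / fact m * q \<le> real (r choose m) / real r ^ m * 1"
  proof (rule LIMSEQ_le[OF lim1 lim2], intro exI allI impI)
    fix n :: nat assume n: "1 \<le> n"
    have "real ((m + n) choose n) * q \<le> real (r choose m) * (real (m + n) / real r) ^ m"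
      using choose_prob_rainbow_le[OF Q C(1), of m "m + n"] binomial_symmetric[of n "m + n"]
      by (simp add: q_def r_def)
    then have "real ((m + n) choose n) * q / real n ^ m
        \<le> real (r choose m) * (real (m + n) / real r) ^ m / real n ^ m"
      by (rule divide_right_mono) simp
    also have "\<dots> = real (r choose m) / real r ^ m * (real (m + n) / real n) ^ m"
      by (simp add: power_divide)
    \<comment> \<open>This needs \<open>n \<noteq> 0\<close>: with division by zero the two sides
      would be 0 and 1.\<close>
    also have "real (m + n) / real n = real m / real n + 1"
      using n by (simp add: field_simps)
    finally show "real ((m + n) choose n) / real (n ^ m) * q
        \<le> real (r choose m) / real r ^ m * (real m / real n + 1) ^ m"
      by simp
  qed
  then have "q \<le> fact m * (real (r choose m) / real r ^ m)"
    by (simp add: divide_le_eq mult.commute)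
  then show ?thesis
    using beta_eq_binomial[OF C(2)] by (simp add: q_def r_def)
qed

section \<open>Sampling nodes without replacement\<close>

definition permutation_array :: "nat \<Rightarrow> (nat \<Rightarrow> nat) \<Rightarrow> nat \<times> nat \<Rightarrow> real" where
  "permutation_array r \<sigma> = (\<lambda>(i, j)\<in>{..<r} \<times> {..<r}. real (\<sigma> i))"

definition permutation_law :: "nat \<Rightarrow> (nat \<times> nat \<Rightarrow> real) measure" where
  "permutation_law r = distr (measure_pmf (pmf_of_set {\<sigma>. \<sigma> permutes {..<r}}))
     (array_space borel {..<r}) (permutation_array r)"

lemma measurable_permutation_array:
  "permutation_array r \<in> measurable (measure_pmf p) (array_space borel {..<r})"
  by (auto simp: permutation_array_def array_space_def space_PiM)

text \<open>Relabelling by \<open>g\<close> turns the array of \<open>\<sigma>\<close> into the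
  array of \<open>\<sigma> \<circ> g\<close>, and composition with \<open>g\<close> is a bijection
  of the permutations, hence preserves their uniform law.\<close>

lemma jointly_exchangeable_permutation_law:
  "jointly_exchangeable borel {..<r} (permutation_law r)"
proof -
  let ?p = "pmf_of_set {\<sigma>. \<sigma> permutes {..<r}}"
  have "distr (permutation_law r) (array_space borel {..<r}) (relabel {..<r} g) = permutation_law r"
    if g: "g permutes {..<r}" for g
  proof -
    have "bij_betw (\<lambda>\<sigma>. \<sigma> \<circ> g) {\<sigma>. \<sigma> permutes {..<r}} {\<sigma>. \<sigma> permutes {..<r}}"
      using g permutes_inv[OF g] permutes_inv_o[OF g]
      by (intro bij_betw_byWitness[where f' = "\<lambda>\<sigma>. \<sigma> \<circ> inv g"])
        (auto simp: comp_assoc intro: permutes_compose)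
    then have map: "map_pmf (\<lambda>\<sigma>. \<sigma> \<circ> g) ?p = ?p"
      using permutes_id[of "{..<r}"]
      by (intro map_pmf_of_set_bij_betw) (auto simp: finite_permutations simp del: permutes_id)
    have "g i < r" if "i < r" for i
      using permutes_in_image[OF g, of i] that by simp
    then have "relabel {..<r} g \<circ> permutation_array r = permutation_array r \<circ> (\<lambda>\<sigma>. \<sigma> \<circ> g)"
      by (auto simp: relabel_def permutation_array_def fun_eq_iff)
    then have "distr (permutation_law r) (array_space borel {..<r}) (relabel {..<r} g)
        = distr (measure_pmf ?p) (array_space borel {..<r}) (permutation_array r \<circ> (\<lambda>\<sigma>. \<sigma> \<circ> g))"
      unfolding permutation_law_def
      by (simp only: distr_distr[OF measurable_relabel[OF g] measurable_permutation_array])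
    also have "\<dots> = distr (distr (measure_pmf ?p) (measure_pmf ?p) (\<lambda>\<sigma>. \<sigma> \<circ> g))
        (array_space borel {..<r}) (permutation_array r)"
      by (rule distr_distr[OF measurable_permutation_array, symmetric]) simp
    also have "distr (measure_pmf ?p) (measure_pmf ?p) (\<lambda>\<sigma>. \<sigma> \<circ> g)
        = measure_pmf (map_pmf (\<lambda>\<sigma>. \<sigma> \<circ> g) ?p)"
      unfolding map_pmf_rep_eq by (intro distr_cong) auto
    finally show ?thesis
      by (simp add: map permutation_law_def)
  qed
  moreover have "prob_space (permutation_law r)"
    unfolding permutation_law_def
    by (intro prob_space.prob_space_distr measurable_permutation_array prob_space_measure_pmf)
  ultimately show ?thesis
    by (simp add: jointly_exchangeable_def permutation_law_def)
qed

text \<open>Every permutation is injective with values in \<open>{..<r}\<close>, so the event holds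
  surely. It is the event that separates this law from all infinitely exchangeable ones.\<close>

lemma prob_rainbow_permutation_law:
  assumes "m \<le> r"
  defines "P \<equiv> submatrix_marginal borel m (permutation_law r)"
  shows "measure P {X \<in> space (array_space borel {..<m}). rainbow {..<m} (real ` {..<r}) X} = 1"
proof -
  let ?p = "pmf_of_set {\<sigma>. \<sigma> permutes {..<r}}"
  let ?E = "{X \<in> space (array_space borel {..<m}). rainbow {..<m} (real ` {..<r}) X}"
  let ?f = "(\<lambda>X. restrict X ({..<m} \<times> {..<m})) \<circ> permutation_array r"
  have sub: "(\<lambda>X. restrict X ({..<m} \<times> {..<m}))
      \<in> measurable (array_space (borel :: real measure) {..<r}) (array_space borel {..<m})"
    using assms(1) by (intro measurable_submatrix) simp
  have P: "P = distr (measure_pmf ?p) (array_space borel {..<m}) ?f"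
    unfolding P_def submatrix_marginal_def permutation_law_def
    by (rule distr_distr[OF sub measurable_permutation_array])
  have f: "?f \<in> measurable (measure_pmf ?p) (array_space borel {..<m})"
    by (rule measurable_comp[OF measurable_permutation_array sub])
  have E: "?E \<in> sets (array_space borel {..<m})"
    by (intro sets_rainbow) (auto intro: borel_closed finite_imp_closed)
  have "?f \<sigma> \<in> ?E" if "\<sigma> permutes {..<r}" for \<sigma>
  proof -
    have diag: "?f \<sigma> (i, i) = real (\<sigma> i)" if "i \<in> {..<m}" for i
      using that assms(1) by (auto simp: permutation_array_def)
    have "inj_on (\<lambda>i. ?f \<sigma> (i, i)) {..<m}"
      using permutes_inj[OF that] by (auto simp: diag inj_on_def simp del: comp_apply)
    moreover have "?f \<sigma> (i, i) \<in> real ` {..<r}" if "i \<in> {..<m}" for i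
      using that assms(1) permutes_in_image[OF \<open>\<sigma> permutes {..<r}\<close>, of i]
      by (simp add: diag del: comp_apply)
    moreover have "?f \<sigma> \<in> space (array_space borel {..<m})"
      using measurable_space[OF f, of \<sigma>] by simp
    ultimately show ?thesis
      by (auto simp: rainbow_def simp del: comp_apply)
  qed
  moreover have "set_pmf ?p = {\<sigma>. \<sigma> permutes {..<r}}"
    using permutes_id[of "{..<r}"] by (intro set_pmf_of_set finite_permutations) (blast, simp)
  ultimately have "AE \<sigma> in measure_pmf ?p. \<sigma> \<in> ?f -` ?E \<inter> space (measure_pmf ?p)"
    by (simp add: AE_measure_pmf_iff del: comp_apply)
  then have "measure (measure_pmf ?p) (?f -` ?E \<inter> space (measure_pmf ?p)) = 1"
    by (subst measure_pmf.prob_eq_1) auto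
  then show ?thesis
    unfolding P using measure_distr[OF f E] by simp
qed

text \<open>Sharpness is claimed for real entries because it fails for some \<open>S\<close>: over a
  one-point space all distances vanish, while \<open>beta m r > 0\<close> once
  \<open>m \<ge> 2\<close>. A single extendible \<open>P\<close> stays at distance at least
  \<open>2 * beta m r\<close> from every projection.\<close>

theorem theorem2:
  fixes S :: "'a measure" and m r :: nat
  assumes "0 < m" and "m \<le> r"
  shows "(\<forall>P. jointly_exchangeable S {..<m} P \<and> extendible S m r P \<longrightarrow>
            (\<exists>Q. jointly_exchangeable S UNIV Q \<and>
                 tv_dist P (submatrix_marginal S m Q) \<le> 2 * beta m r))
       \<and> (\<exists>P. jointly_exchangeable (borel :: real measure) {..<m} P \<and> extendible borel m r P \<and>
            (\<forall>Q. jointly_exchangeable borel UNIV Q \<longrightarrow>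
                 tv_dist P (submatrix_marginal borel m Q) \<ge> 2 * beta m r))"
proof (intro conjI allI impI)
  fix P
  assume "jointly_exchangeable S {..<m} P \<and> extendible S m r P"
  then obtain R where R: "jointly_exchangeable S {..<r} R" and P: "P = submatrix_marginal S m R"
    unfolding extendible_def by blast
  interpret node_sampling S r R
    using assms R by unfold_locales auto
  have "tv_dist P (submatrix_marginal S m mixture) \<le> 2 * beta m r"
    unfolding P
    by (intro tv_dist_le measure_mixture_marginal assms(2)) (simp add: submatrix_marginal_def)
  then show "\<exists>Q. jointly_exchangeable S UNIV Q \<and>
      tv_dist P (submatrix_marginal S m Q) \<le> 2 * beta m r"
    using jointly_exchangeable_mixture by blast
next
  let ?P = "submatrix_marginal borel m (permutation_law r)"
  let ?E = "{X \<in> space (array_space borel {..<m}). rainbow {..<m} (real ` {..<r}) X}"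
  have P: "jointly_exchangeable borel {..<m} ?P"
    using assms(2)
    by (intro jointly_exchangeable_submatrix_marginal[OF jointly_exchangeable_permutation_law]) simp
  have ext: "extendible borel m r ?P"
    unfolding extendible_def using jointly_exchangeable_permutation_law by blast
  have "2 * beta m r \<le> tv_dist ?P (submatrix_marginal borel m Q)"
    if Q: "jointly_exchangeable borel UNIV Q" for Q
  proof -
    let ?res = "\<lambda>X. restrict X ({..<m} \<times> {..<m})"
    have setsQ: "sets Q = sets (array_space borel UNIV)"
      using Q by (simp add: jointly_exchangeable_def)
    have E: "?E \<in> sets (array_space borel {..<m})"
      by (intro sets_rainbow) (auto intro: borel_closed finite_imp_closed)
    have res: "?res \<in> measurable Q (array_space borel {..<m})"
      unfolding measurable_cong_sets[OF setsQ refl] by (rule measurable_submatrix) simp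
    \<comment> \<open>Restriction to the leading submatrix keeps the first \<open>m\<close> diagonal
      entries, so the event can be evaluated under \<open>Q\<close> itself.\<close>
    have "rainbow {..<m} C (?res X) \<longleftrightarrow> rainbow {..<m} C X" for C and X :: "nat \<times> nat \<Rightarrow> real"
      by (simp add: rainbow_def inj_on_def image_subset_iff)
    then have "?res -` ?E \<inter> space Q = {X \<in> space Q. rainbow {..<m} (real ` {..<r}) X}"
      using measurable_space[OF res] by auto
    then have "measure (submatrix_marginal borel m Q) ?E
        = measure Q {X \<in> space Q. rainbow {..<m} (real ` {..<r}) X}"
      unfolding submatrix_marginal_def using measure_distr[OF res E] by simp
    also have "\<dots> \<le> 1 - beta m r"
      using prob_rainbow_le[OF Q, of "real ` {..<r}" m] assms(2) by (simp add: card_image)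
    finally have bound: "beta m r \<le> measure ?P ?E - measure (submatrix_marginal borel m Q) ?E"
      by (simp add: prob_rainbow_permutation_law[OF assms(2)])
    have "prob_space ?P" "prob_space (submatrix_marginal borel m Q)"
      using P jointly_exchangeable_submatrix_marginal[OF Q, of m]
      by (simp_all add: jointly_exchangeable_def)
    then have "2 * (measure ?P ?E - measure (submatrix_marginal borel m Q) ?E)
        \<le> tv_dist ?P (submatrix_marginal borel m Q)"
      by (rule tv_dist_ge) (use E in \<open>simp add: submatrix_marginal_def\<close>)
    then show ?thesis
      by (rule order_trans[OF mult_left_mono[OF bound zero_le_numeral]])
  qed
  then show "\<exists>P. jointly_exchangeable (borel :: real measure) {..<m} P \<and> extendible borel m r P \<and>
      (\<forall>Q. jointly_exchangeable borel UNIV Q \<longrightarrow>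
        tv_dist P (submatrix_marginal borel m Q) \<ge> 2 * beta m r)"
    using P ext by blast
qed

end
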